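(* Let $X$ be a real normed space and let $K\subset X$ be a convex body. Then for arbitrary $\mathbf{x}\in K$ we have $$\nu(K,\mathbf{x})=\frac{1-\sigma(K,\mathbf{x})}{1+\sigma(K,\mathbf{x})}.$$
   Context: $X$ is a real normed space, $X\neq\{0\}$, with unit sphere $S$. A convex body is a bounded, closed, convex set with nonempty interior. For $\mathbf{x}\in X$ let $\mathcal{L}=\mathcal{L}(K,\mathbf{x})$ be the set of straight lines $l=\{\mathbf{x}+t\mathbf{v}:t\in\mathbb{R}\}$, $\mathbf{v}\in S$, that meet $K$ in more than one point; for $l\in\mathcal{L}$ write $K\cap l=[\mathbf{a},\mathbf{b}]$, $\mathbf{a}\neq\mathbf{b}$, with endpoints labelled so that $\|\mathbf{x}-\mathbf{b}\|\le\|\mathbf{x}-\mathbf{a}\|$. Define $$\sigma(K,\mathbf{x})=\inf_{l\in\mathcal{L}}\frac{\|\mathbf{b}-\mathbf{x}\|}{\|\mathbf{a}-\mathbf{x}\|}\quad(\mathbf{x}\in X),\qquad \nu(K,\mathbf{x})=\sup_{l\in\mathcal{L}}\frac{\|2\mathbf{x}-\mathbf{a}-\mathbf{b}\|}{\|\mathbf{b}-\mathbf{a}\|}\quad(\mathbf{x}\in K).$$ *)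

theory Defs
  imports "HOL-Analysis.Analysis"
begin

definition convex_body :: "'a::real_normed_vector set \<Rightarrow> bool" where
  "convex_body K \<longleftrightarrow> bounded K \<and> closed K \<and> convex K \<and> interior K \<noteq> {}"

definition line_through :: "'a::real_normed_vector \<Rightarrow> 'a \<Rightarrow> 'a set" where
  "line_through x v = {x + t *\<^sub>R v | t::real. True}"

definition chord_lines :: "'a::real_normed_vector set \<Rightarrow> 'a \<Rightarrow> 'a set set" where
  "chord_lines K x =
     {l. (\<exists>v\<in>sphere 0 1. l = line_through x v) \<and> (\<exists>p\<in>K \<inter> l. \<exists>q\<in>K \<inter> l. p \<noteq> q)}"

(* The pairs (a, b) of endpoints of the chord of K on l, labelled so that b is
   at least as close to x as a. For a convex body K and a line l in chord_lines K x
   there is exactly one such pair, except when both endpoints are equally far from x;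
   then both labellings belong to the set, and the quotients used in sigma_fn and nu_fn
   are the same for both. The condition a \<noteq> b forces a \<noteq> x. *)
definition chord_endpoints :: "'a::real_normed_vector set \<Rightarrow> 'a \<Rightarrow> 'a set \<Rightarrow> ('a \<times> 'a) set" where
  "chord_endpoints K x l =
     {(a, b). K \<inter> l = closed_segment a b \<and> a \<noteq> b \<and> norm (x - b) \<le> norm (x - a)}"

definition sigma_fn :: "'a::real_normed_vector set \<Rightarrow> 'a \<Rightarrow> real" where
  "sigma_fn K x =
     (INF (a, b) \<in> (\<Union>l\<in>chord_lines K x. chord_endpoints K x l). norm (b - x) / norm (a - x))"

(* Only meaningful for x in K, where every quotient is at most 1; outside K the
   quotients may be unbounded and the real supremum is then unspecified. *)
definition nu_fn :: "'a::real_normed_vector set \<Rightarrow> 'a \<Rightarrow> real" where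
  "nu_fn K x =
     (SUP (a, b) \<in> (\<Union>l\<in>chord_lines K x. chord_endpoints K x l).
        norm (2 *\<^sub>R x - a - b) / norm (b - a))"

end

theory Submission
  imports Defs
begin

text \<open>
  On one chord the identity is elementary. Since \<open>x \<in> K\<close>, the point \<open>x\<close> lies on the chord,
  so \<open>x = (1 - t) a + t b\<close> with \<open>t \<ge> 1/2\<close>, because \<open>b\<close> is the nearer endpoint. Both quotients
  depend only on \<open>t\<close>: they are \<open>r = (1 - t) / t\<close> and \<open>2 t - 1 = (1 - r) / (1 + r)\<close>.

  The map \<open>r \<mapsto> (1 - r) / (1 + r)\<close> is decreasing and is its own inverse on \<open>(-1, \<infinity>)\<close>. It therefore
  turns upper bounds of the values \<open>(1 - r) / (1 + r)\<close> into lower bounds of the values \<open>r\<close> and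
  vice versa, and so carries the infimum of the \<open>r\<close> to the supremum of their images. In the
  conditionally complete order of the reals this needs the family of chords to be nonempty: a
  convex body has a point other than \<open>x\<close>, and by compactness the line joining it to \<open>x\<close> cuts
  \<open>K\<close> in a nondegenerate segment.
\<close>

lemma chord_quotients:
  fixes a b x :: "'a::real_normed_vector"
  assumes x: "x \<in> closed_segment a b" and ab: "a \<noteq> b" and near: "norm (x - b) \<le> norm (x - a)"
  shows "norm (2 *\<^sub>R x - a - b) / norm (b - a) =
    (1 - norm (b - x) / norm (a - x)) / (1 + norm (b - x) / norm (a - x))"
proof -
  obtain t where t: "0 \<le> t" "t \<le> 1" and x_eq: "x = (1 - t) *\<^sub>R a + t *\<^sub>R b"
    using x by (auto simp: in_segment)
  have pos: "norm (b - a) > 0"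
    using ab by simp
  have "b - x = (1 - t) *\<^sub>R (b - a)" "a - x = - t *\<^sub>R (b - a)"
    "2 *\<^sub>R x - a - b = (2 * t - 1) *\<^sub>R (b - a)"
    unfolding x_eq by (simp_all add: algebra_simps scaleR_2)
  then have n: "norm (b - x) = (1 - t) * norm (b - a)" "norm (a - x) = t * norm (b - a)"
    "norm (2 *\<^sub>R x - a - b) = \<bar>2 * t - 1\<bar> * norm (b - a)"
    using t by simp_all
  have half: "t \<ge> 1 / 2"
    using near pos by (simp add: norm_minus_commute n)
  have "norm (2 *\<^sub>R x - a - b) / norm (b - a) = 2 * t - 1"
    using half pos by (simp add: n)
  moreover have "norm (b - x) / norm (a - x) = (1 - t) / t"
    using pos by (simp add: n)
  moreover have "2 * t - 1 = (1 - (1 - t) / t) / (1 + (1 - t) / t)"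
    using half by (simp add: field_simps)
  ultimately show ?thesis
    by (simp only:)
qed

lemma SUP_reflected_eq_reflected_INF:
  fixes f :: "'i \<Rightarrow> real"
  assumes "I \<noteq> {}" and nonneg: "\<And>i. i \<in> I \<Longrightarrow> 0 \<le> f i"
  shows "(SUP i\<in>I. (1 - f i) / (1 + f i)) = (1 - (INF i\<in>I. f i)) / (1 + (INF i\<in>I. f i))"
proof -
  define s where "s = (INF i\<in>I. f i)"
  have bdd: "bdd_below (f ` I)"
    using nonneg by (intro bdd_belowI[of _ 0]) auto
  have s0: "0 \<le> s"
    unfolding s_def using assms by (intro cINF_greatest)
  have "(SUP i\<in>I. (1 - f i) / (1 + f i)) = (1 - s) / (1 + s)"
  proof (rule cSup_eq_non_empty)
    fix z assume "z \<in> (\<lambda>i. (1 - f i) / (1 + f i)) ` I"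
    then obtain i where i: "i \<in> I" "z = (1 - f i) / (1 + f i)"
      by auto
    have "s \<le> f i"
      unfolding s_def by (rule cINF_lower[OF bdd i(1)])
    then show "z \<le> (1 - s) / (1 + s)"
      using s0 by (simp add: i field_simps)
  next
    fix y assume "\<And>z. z \<in> (\<lambda>i. (1 - f i) / (1 + f i)) ` I \<Longrightarrow> z \<le> y"
    then have y: "(1 - f i) / (1 + f i) \<le> y" if "i \<in> I" for i
      using that by blast
    obtain j where j: "j \<in> I"
      using assms(1) by blast
    \<comment> \<open>An upper bound stays in the range where the reflection is decreasing.\<close>
    have "-1 < (1 - f j) / (1 + f j)"
      using nonneg[OF j] by (simp add: field_simps)
    then have y1: "-1 < y"
      using y[OF j] by linarith
    have "(1 - y) / (1 + y) \<le> s"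
      unfolding s_def
    proof (rule cINF_greatest[OF assms(1)])
      fix i assume "i \<in> I"
      then show "(1 - y) / (1 + y) \<le> f i"
        using y[of i] nonneg[of i] y1 by (simp add: field_simps)
    qed
    then show "(1 - s) / (1 + s) \<le> y"
      using s0 y1 by (simp add: field_simps)
  qed (use assms(1) in simp)
  then show ?thesis
    by (simp add: s_def)
qed

text \<open>In the arc-length parametrisation of the line, \<open>K\<close> cuts out a compact interval of the reals;
  this gives compactness of the chord in any dimension, although \<open>K\<close> itself need not be compact.\<close>

lemma line_section_is_segment:
  fixes K :: "'a::real_normed_vector set"
  assumes "bounded K" "closed K" "convex K" and v: "norm v = 1"
  obtains a b where "K \<inter> line_through x v = closed_segment a b"
  | "K \<inter> line_through x v = {}"
proof -
  define g where "g = (\<lambda>t. x + t *\<^sub>R v)"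
  define T where "T = g -` K"
  have chord: "K \<inter> line_through x v = g ` T"
    by (auto simp: T_def g_def line_through_def)
  have "closed T"
    unfolding T_def g_def by (intro closed_vimage assms continuous_intros)
  moreover have "bounded T"
  proof -
    obtain B where B: "\<And>y. y \<in> K \<Longrightarrow> norm y \<le> B"
      using assms(1) by (auto simp: bounded_iff)
    have "norm t \<le> B + norm x" if "t \<in> T" for t
    proof -
      have "norm t = norm (g t - x)"
        by (simp add: g_def v)
      also have "\<dots> \<le> norm (g t) + norm x"
        by (rule norm_triangle_ineq4)
      finally show ?thesis
        using B[of "g t"] that by (simp add: T_def)
    qed
    then show ?thesis
      by (auto simp: bounded_iff)
  qed
  moreover have "convex T"
  proof (rule convexI)
    fix s t u w :: real
    assume st: "s \<in> T" "t \<in> T" and uw: "0 \<le> u" "0 \<le> w" "u + w = 1"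
    have "u *\<^sub>R x + w *\<^sub>R x = x"
      using uw by (simp flip: scaleR_add_left)
    then have "g (u *\<^sub>R s + w *\<^sub>R t) = u *\<^sub>R g s + w *\<^sub>R g t"
      by (simp add: g_def algebra_simps)
    moreover have "u *\<^sub>R g s + w *\<^sub>R g t \<in> K"
      using st uw by (intro convexD[OF assms(3)]) (auto simp: T_def)
    ultimately show "u *\<^sub>R s + w *\<^sub>R t \<in> T"
      by (simp add: T_def)
  qed
  ultimately obtain c d where cd: "T = {c..d}"
    using connected_compact_interval_1[of T] convex_connected compact_eq_bounded_closed by auto
  show thesis
  proof (cases "c \<le> d")
    case True
    have "g ` T = (+) x ` (\<lambda>t. t *\<^sub>R v) ` closed_segment c d"
      using True by (simp add: cd g_def image_image closed_segment_eq_real_ivl)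
    also have "\<dots> = closed_segment (g c) (g d)"
      by (simp add: closed_segment_translation g_def
          closed_segment_linear_image[OF linear_scaleR_left, symmetric])
    finally show thesis
      using that(1) chord by simp
  next
    case False
    then show thesis
      using that(2) chord cd by simp
  qed
qed

lemma convex_body_has_chord:
  fixes K :: "'a::real_normed_vector set"
  assumes nontriv: "(UNIV :: 'a set) \<noteq> {0}" and K: "convex_body K" and "x \<in> K"
  shows "\<exists>l\<in>chord_lines K x. chord_endpoints K x l \<noteq> {}"
proof -
  have "\<not> K \<subseteq> {x}"
  proof
    assume "K \<subseteq> {x}"
    then have int: "interior K = {x}"
      using K interior_subset[of K] unfolding convex_body_def by blast
    \<comment> \<open>An open singleton would make the connected space itself a singleton.\<close>
    have "open {x}"
      using int by (metis open_interior)
    then have "{x} = (UNIV :: 'a set)"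
      using clopen[of "{x}"] by simp
    then show False
      using nontriv by (metis UNIV_I singletonD)
  qed
  then obtain q where q: "q \<in> K" "q \<noteq> x"
    by blast
  define v where "v = (1 / norm (q - x)) *\<^sub>R (q - x)"
  define l where "l = line_through x v"
  have v: "norm v = 1"
    using q by (simp add: v_def)
  have "x = x + 0 *\<^sub>R v" "q = x + norm (q - x) *\<^sub>R v"
    using q by (simp_all add: v_def)
  then have xl: "x \<in> K \<inter> l" and ql: "q \<in> K \<inter> l"
    using q(1) \<open>x \<in> K\<close> unfolding l_def line_through_def by blast+
  have chord: "l \<in> chord_lines K x"
    unfolding chord_lines_def using v xl ql q(2) l_def by auto
  obtain a b where ab: "K \<inter> l = closed_segment a b"
    using line_section_is_segment[of K v x] K v xl unfolding convex_body_def l_def by blast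
  have "a \<noteq> b"
    using ab xl ql q(2) by auto
  then have "(a, b) \<in> chord_endpoints K x l \<or> (b, a) \<in> chord_endpoints K x l"
    using ab by (auto simp: chord_endpoints_def closed_segment_commute)
  then show ?thesis
    using chord by blast
qed

theorem proposition4p9:
  fixes K :: "'a::real_normed_vector set" and x :: 'a
  assumes "(UNIV :: 'a set) \<noteq> {0}"
    and "convex_body K"
    and "x \<in> K"
  shows "nu_fn K x = (1 - sigma_fn K x) / (1 + sigma_fn K x)"
proof -
  define P where "P = (\<Union>l\<in>chord_lines K x. chord_endpoints K x l)"
  define r where "r = (\<lambda>(a, b). norm (b - x) / norm (a - x))"
  have "P \<noteq> {}"
    unfolding P_def using convex_body_has_chord[OF assms] by blast
  have quot: "norm (2 *\<^sub>R x - a - b) / norm (b - a) = (1 - r (a, b)) / (1 + r (a, b))"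
    if "(a, b) \<in> P" for a b
  proof -
    obtain l where l: "l \<in> chord_lines K x" and ab: "(a, b) \<in> chord_endpoints K x l"
      using \<open>(a, b) \<in> P\<close> unfolding P_def by blast
    obtain v where "l = line_through x v"
      using l unfolding chord_lines_def by blast
    moreover have "x = x + 0 *\<^sub>R v"
      by simp
    ultimately have "x \<in> l"
      unfolding line_through_def by blast
    then show ?thesis
      using ab \<open>x \<in> K\<close> chord_quotients[of x a b] by (auto simp: chord_endpoints_def r_def)
  qed
  have "nu_fn K x = (SUP p\<in>P. (1 - r p) / (1 + r p))"
    unfolding nu_fn_def P_def[symmetric] by (rule SUP_cong) (auto simp: quot)
  also have "\<dots> = (1 - (INF p\<in>P. r p)) / (1 + (INF p\<in>P. r p))"
    using \<open>P \<noteq> {}\<close> by (rule SUP_reflected_eq_reflected_INF) (auto simp: r_def)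
  also have "(INF p\<in>P. r p) = sigma_fn K x"
    by (simp add: sigma_fn_def P_def r_def)
  finally show ?thesis .
qed

end
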